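(* Let $A,B\in M_2$ be such that $\operatorname{tr} A=\operatorname{tr} B=0$. Then $W_A(B)=W_{A\oplus 0}(B\oplus 0)$. Moreover, if both $A$ and $B$ are nonzero, then the largest possible $\alpha$ such that $\alpha W(A)W(B)\subseteq W_A(B)$ satisfies $2\le\alpha\le 4$.
   Context: $M_n$ is the space of $n\times n$ complex matrices and $U_n$ the group of $n\times n$ unitary matrices. For $B\in M_n$, the classical numerical range is $W(B)=\{x^*Bx : x\in\mathbb{C}^n,\ x^*x=1\}$. For $A,B\in M_n$, the $A$-numerical range of $B$ is $W_A(B)=\{\operatorname{tr}(A\,VBV^* ) : V\in U_n\}$. For $X\in M_2$, $X\oplus 0\in M_3$ denotes the direct sum of $X$ with the $1\times 1$ zero matrix. For real $\alpha$, $\alpha W(A)W(B)=\{\alpha ab : a\in W(A),\ b\in W(B)\}$; "largest possible $\alpha$" is among real numbers. *)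

theory Defs
  imports "HOL-Analysis.Analysis"
begin

definition ctranspose :: "complex^'n^'m \<Rightarrow> complex^'m^'n" where
  "ctranspose X = (\<chi> i j. cnj (X $ j $ i))"

definition unitary_matrix :: "complex^'n^'n \<Rightarrow> bool" where
  "unitary_matrix V \<longleftrightarrow> ctranspose V ** V = mat 1 \<and> V ** ctranspose V = mat 1"

text \<open>The product \<open>x\<^sup>* y\<close> of two complex vectors, conjugate-linear in the first argument.
  The library's \<open>x \<bullet> y\<close> on \<open>complex^'n\<close> is only the real part of this.\<close>

definition cdot :: "complex^'n \<Rightarrow> complex^'n \<Rightarrow> complex" where
  "cdot x y = (\<Sum>i\<in>UNIV. cnj (x $ i) * y $ i)"

definition numerical_range :: "complex^'n^'n \<Rightarrow> complex set" where
  "numerical_range B = {cdot x (B *v x) | x. cdot x x = 1}"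

definition A_numerical_range :: "complex^'n^'n \<Rightarrow> complex^'n^'n \<Rightarrow> complex set" where
  "A_numerical_range A B = {trace (A ** (V ** B ** ctranspose V)) | V. unitary_matrix V}"

definition direct_sum_zero :: "complex^2^2 \<Rightarrow> complex^3^3" where
  "direct_sum_zero X = vector [vector [X $ 1 $ 1, X $ 1 $ 2, 0],
                               vector [X $ 2 $ 1, X $ 2 $ 2, 0],
                               vector [0, 0, 0]]"

definition scaled_product :: "real \<Rightarrow> complex set \<Rightarrow> complex set \<Rightarrow> complex set" where
  "scaled_product \<alpha> S T = {complex_of_real \<alpha> * a * b | a b. a \<in> S \<and> b \<in> T}"

end

theory Submission
  imports Defs
begin

text \<open>
  A trace-zero \<open>2 \<times> 2\<close> matrix is unitarily similar to one with zero diagonal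
  (\<open>trace_zero_similar_offdiag\<close>), and all the sets in question are invariant under unitary
  similarity. So let \<open>A\<close> and \<open>B\<close> have zero diagonal, with off-diagonal entries \<open>p, q\<close> and \<open>r, s\<close>.
  For \<open>V\<close> unitary, a direct computation gives
  \<open>tr (A V B V\<^sup>*) = p s cnj \<alpha> + q r \<alpha> + p r cnj \<beta> + q s \<beta>\<close> with
  \<open>\<alpha> = v\<^sub>1\<^sub>1 cnj v\<^sub>2\<^sub>2\<close> and \<open>\<beta> = v\<^sub>1\<^sub>2 cnj v\<^sub>2\<^sub>1\<close>. Write \<open>L (\<alpha>, \<beta>)\<close> for this number.
  The rows of \<open>V\<close> have norm one, so \<open>|\<alpha>| + |\<beta>| \<le> 1\<close>, and every pair with \<open>|\<alpha>| + |\<beta>| = 1\<close> arises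
  in this way. The real-linear map \<open>L\<close> goes from a real space of dimension four to one of dimension
  two, so it has a nontrivial kernel; moving along a kernel direction until the sphere
  \<open>|\<alpha>| + |\<beta>| = 1\<close> is hit shows that the ball and the sphere have the same image under \<open>L\<close>. Hence
  \<open>W\<^sub>A(B)\<close> is the image of the ball (\<open>A_numerical_range_offdiag\<close>).

  For \<open>A \<oplus> 0\<close> and \<open>B \<oplus> 0\<close> the trace is given by the same formula in the entries of a \<open>3 \<times> 3\<close> unitary
  matrix, whose first two rows still force \<open>|\<alpha>| + |\<beta>| \<le> 1\<close>. So nothing new is obtained.

  Finally, the points of \<open>W(A)\<close> have the form \<open>p w + q cnj w\<close> with \<open>|w| \<le> 1/2\<close>, and similarly for
  \<open>W(B)\<close> with \<open>r z + s cnj z\<close>. Twice the product of two such points is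
  \<open>L (2 cnj w z, 2 cnj w cnj z)\<close>, so the factor 2 is admissible. The set \<open>W(A)\<close> contains a point of
  modulus \<open>(|p| + |q|)/2\<close>, the set \<open>W(B)\<close> one of modulus \<open>(|r| + |s|)/2\<close>, while \<open>W\<^sub>A(B)\<close> lies in the
  disc of radius \<open>(|p| + |q|)(|r| + |s|)\<close>; so no factor above 4 is admissible when \<open>A\<close> and \<open>B\<close> are
  nonzero. The supremum of the admissible factors is attained because \<open>W\<^sub>A(B)\<close> is compact.
\<close>

section \<open>Unitary matrices and unitary similarity\<close>

lemma ctranspose_nth [simp]: "ctranspose X $ i $ j = cnj (X $ j $ i)"
  by (simp add: ctranspose_def)

lemma ctranspose_mult: "ctranspose (X ** Y) = ctranspose Y ** ctranspose X"
  by (simp add: vec_eq_iff matrix_matrix_mult_def mult.commute)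

lemma ctranspose_ctranspose [simp]: "ctranspose (ctranspose X) = X"
  by (simp add: vec_eq_iff)

lemma unitary_matrixD:
  assumes "unitary_matrix V"
  shows "ctranspose V ** V = mat 1" "V ** ctranspose V = mat 1"
  using assms by (auto simp: unitary_matrix_def)

lemma unitary_cancel:
  assumes "unitary_matrix V"
  shows "ctranspose V ** (V ** X) = X" "V ** (ctranspose V ** X) = X"
  using unitary_matrixD[OF assms] by (simp_all add: matrix_mul_assoc)

lemma unitary_matrix_ctranspose:
  "unitary_matrix V \<Longrightarrow> unitary_matrix (ctranspose V)"
  by (simp add: unitary_matrix_def)

lemma unitary_matrix_mult:
  assumes "unitary_matrix U" "unitary_matrix V"
  shows "unitary_matrix (U ** V)"
  by (simp add: unitary_matrix_def ctranspose_mult matrix_mul_assoc[symmetric]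
      unitary_cancel[OF assms(1)] unitary_cancel[OF assms(2)]
      unitary_matrixD[OF assms(1)] unitary_matrixD[OF assms(2)])

lemma unitary_row_norm:
  assumes "unitary_matrix V"
  shows "(\<Sum>j\<in>UNIV. (cmod (V $ i $ j))\<^sup>2) = 1"
proof -
  have "(\<Sum>j\<in>UNIV. V $ i $ j * cnj (V $ i $ j)) = 1"
    using arg_cong[OF unitary_matrixD(2)[OF assms], of "\<lambda>M. M $ i $ i"]
    by (simp add: matrix_matrix_mult_def mat_def)
  then have "complex_of_real (\<Sum>j\<in>UNIV. (cmod (V $ i $ j))\<^sup>2) = 1"
    by (simp add: complex_norm_square del: of_real_power)
  then show ?thesis by (metis of_real_eq_1_iff)
qed

lemma cdot_ctranspose: "cdot (ctranspose U *v x) y = cdot x (U *v y)"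
proof -
  have "cdot (ctranspose U *v x) y = (\<Sum>i\<in>UNIV. \<Sum>j\<in>UNIV. U $ j $ i * cnj (x $ j) * y $ i)"
    by (simp add: cdot_def matrix_vector_mult_def sum_distrib_right)
  also have "\<dots> = (\<Sum>j\<in>UNIV. \<Sum>i\<in>UNIV. U $ j $ i * cnj (x $ j) * y $ i)"
    by (rule sum.swap)
  also have "\<dots> = cdot x (U *v y)"
    by (simp add: cdot_def matrix_vector_mult_def sum_distrib_left algebra_simps)
  finally show ?thesis .
qed

lemma numerical_range_similar_subset:
  assumes U: "unitary_matrix U"
  shows "numerical_range (U ** B ** ctranspose U) \<subseteq> numerical_range B"
proof
  fix z assume "z \<in> numerical_range (U ** B ** ctranspose U)"
  then obtain x where x: "cdot x x = 1" and z: "z = cdot x ((U ** B ** ctranspose U) *v x)"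
    by (auto simp: numerical_range_def)
  let ?y = "ctranspose U *v x"
  have "cdot ?y ?y = 1"
    using x by (simp add: cdot_ctranspose matrix_vector_mul_assoc unitary_matrixD[OF U])
  moreover have "z = cdot ?y (B *v ?y)"
    using z by (simp add: cdot_ctranspose matrix_vector_mul_assoc matrix_mul_assoc)
  ultimately show "z \<in> numerical_range B" by (auto simp: numerical_range_def)
qed

lemma numerical_range_similar:
  assumes U: "unitary_matrix U"
  shows "numerical_range (U ** B ** ctranspose U) = numerical_range B"
proof
  have "B = ctranspose U ** (U ** B ** ctranspose U) ** ctranspose (ctranspose U)"
    by (simp add: matrix_mul_assoc[symmetric] unitary_cancel[OF U] unitary_matrixD[OF U])
  then show "numerical_range B \<subseteq> numerical_range (U ** B ** ctranspose U)"
    using numerical_range_similar_subset[OF unitary_matrix_ctranspose[OF U]] by metis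
qed (rule numerical_range_similar_subset[OF U])

lemma A_numerical_range_similar_subset:
  assumes U: "unitary_matrix U" and W: "unitary_matrix W"
  shows "A_numerical_range (U ** A ** ctranspose U) (W ** B ** ctranspose W) \<subseteq> A_numerical_range A B"
proof
  fix z assume "z \<in> A_numerical_range (U ** A ** ctranspose U) (W ** B ** ctranspose W)"
  then obtain V where V: "unitary_matrix V"
    and z: "z = trace (U ** A ** ctranspose U ** (V ** (W ** B ** ctranspose W) ** ctranspose V))"
    by (auto simp: A_numerical_range_def)
  let ?X = "ctranspose U ** V ** W"
  have "unitary_matrix ?X" by (intro unitary_matrix_mult unitary_matrix_ctranspose U V W)
  moreover have "z = trace (A ** (?X ** B ** ctranspose ?X))"
    unfolding z using trace_mul_sym[of U]
    by (simp add: ctranspose_mult matrix_mul_assoc[symmetric])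
  ultimately show "z \<in> A_numerical_range A B" by (auto simp: A_numerical_range_def)
qed

lemma A_numerical_range_similar:
  assumes U: "unitary_matrix U" and W: "unitary_matrix W"
  shows "A_numerical_range (U ** A ** ctranspose U) (W ** B ** ctranspose W) = A_numerical_range A B"
proof
  have "A = ctranspose U ** (U ** A ** ctranspose U) ** ctranspose (ctranspose U)"
       "B = ctranspose W ** (W ** B ** ctranspose W) ** ctranspose (ctranspose W)"
    by (simp_all add: matrix_mul_assoc[symmetric] unitary_cancel[OF U] unitary_matrixD[OF U]
        unitary_cancel[OF W] unitary_matrixD[OF W])
  then show "A_numerical_range A B \<subseteq> A_numerical_range (U ** A ** ctranspose U) (W ** B ** ctranspose W)"
    using A_numerical_range_similar_subset[OF unitary_matrix_ctranspose[OF U] unitary_matrix_ctranspose[OF W]]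
    by metis
qed (rule A_numerical_range_similar_subset[OF U W])

section \<open>Zero-diagonal form of a trace-zero matrix\<close>

text \<open>The \<open>2 \<times> 2\<close> matrix with rows \<open>(a, b)\<close> and \<open>(c, d)\<close>.\<close>

definition mat2 :: "complex \<Rightarrow> complex \<Rightarrow> complex \<Rightarrow> complex \<Rightarrow> complex^2^2" where
  "mat2 a b c d = vector [vector [a, b], vector [c, d]]"

lemma mat2_nth [simp]:
  "mat2 a b c d $ 1 $ 1 = a" "mat2 a b c d $ 1 $ 2 = b"
  "mat2 a b c d $ 2 $ 1 = c" "mat2 a b c d $ 2 $ 2 = d"
  by (simp_all add: mat2_def)

lemma unitary_mat2:
  assumes "(cmod g)\<^sup>2 + (cmod h)\<^sup>2 = 1"
  shows "unitary_matrix (mat2 g h (- cnj h) (cnj g))"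
proof -
  have "g * cnj g + h * cnj h = 1"
    using assms by (metis complex_norm_square of_real_1 of_real_add)
  then show ?thesis
    by (simp add: unitary_matrix_def vec_eq_iff forall_2 matrix_matrix_mult_def sum_2 mat_def
        algebra_simps)
qed

text \<open>The number zero lies in the numerical range of the trace-zero matrix with rows
  \<open>(a, b)\<close> and \<open>(c, -a)\<close>.\<close>

lemma exists_zero_quadratic:
  fixes a b c :: complex
  obtains x y where "(cmod x)\<^sup>2 + (cmod y)\<^sup>2 = 1"
    "a * (x * cnj x - y * cnj y) + b * cnj x * y + c * cnj y * x = 0"
proof (cases "a = 0")
  case True
  show ?thesis by (rule that[of 1 0]) (simp_all add: True)
next
  case False
  \<comment> \<open>The phase \<open>z\<close> makes \<open>b z + c cnj z\<close> a real multiple of \<open>a\<close>; for the vector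
    \<open>(cos (t/2), z sin (t/2))\<close> the equation then becomes one real equation in \<open>t\<close>.\<close>
  define m where "m = cnj a * b - a * cnj c"
  define z where "z = (if m = 0 then 1 else cnj m / cmod m)"
  have z: "cmod z = 1" by (simp add: z_def norm_divide)
  have "Im (m * z) = 0"
    by (simp add: z_def complex_mult_cnj)
  then have im: "Im (cnj a * (b * z + c * cnj z)) = 0"
    by (simp add: m_def algebra_simps)
  define k where "k = Re (cnj a * (b * z + c * cnj z)) / (cmod a)\<^sup>2"
  have "cnj a * (b * z + c * cnj z) = of_real (k * (cmod a)\<^sup>2)"
    using im False by (simp add: k_def complex_eq_iff)
  also have "\<dots> = cnj a * (of_real k * a)"
    by (simp add: complex_norm_square mult_ac del: of_real_power)
  finally have k: "b * z + c * cnj z = of_real k * a" using False by simp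
  have "\<exists>t. 0 \<le> t \<and> t \<le> pi \<and> - (cos t + k / 2 * sin t) = 0"
    by (rule IVT') (auto intro!: continuous_intros)
  then obtain t where "- (cos t + k / 2 * sin t) = 0" by blast
  then have t: "cos t + k / 2 * sin t = 0" by linarith
  define x y where "x = complex_of_real (cos (t/2))" and "y = of_real (sin (t/2)) * z"
  show ?thesis
  proof (rule that[of x y])
    show "(cmod x)\<^sup>2 + (cmod y)\<^sup>2 = 1"
      by (simp add: x_def y_def norm_mult z)
    have zz: "z * cnj z = 1" using z by (simp add: complex_norm_square[symmetric])
    have "y * cnj y = of_real ((sin (t/2))\<^sup>2) * (z * cnj z)"
      by (simp add: y_def power2_eq_square)
    then have "a * (x * cnj x - y * cnj y) + b * cnj x * y + c * cnj y * x
        = a * of_real ((cos (t/2))\<^sup>2 - (sin (t/2))\<^sup>2)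
          + of_real (cos (t/2) * sin (t/2)) * (b * z + c * cnj z)"
      by (simp add: zz x_def y_def power2_eq_square algebra_simps)
    also have "\<dots> = a * of_real ((cos (t/2))\<^sup>2 - (sin (t/2))\<^sup>2 + k / 2 * (2 * sin (t/2) * cos (t/2)))"
      by (simp add: k algebra_simps)
    also have "\<dots> = a * of_real (cos t + k / 2 * sin t)"
      using cos_double[of "t/2"] sin_double[of "t/2"] by simp
    finally show "a * (x * cnj x - y * cnj y) + b * cnj x * y + c * cnj y * x = 0"
      by (simp only: t) simp
  qed
qed

text \<open>Complete a unit vector at which the quadratic form of \<open>A\<close> vanishes to an orthonormal basis:
  in this basis one diagonal entry is zero, hence so is the other.\<close>

lemma trace_zero_similar_offdiag:
  fixes A :: "complex^2^2"
  assumes "trace A = 0"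
  obtains U p q where "unitary_matrix U" "A = U ** mat2 0 p q 0 ** ctranspose U"
proof -
  obtain x y where n: "(cmod x)\<^sup>2 + (cmod y)\<^sup>2 = 1"
    and xy: "A$1$1 * (x * cnj x - y * cnj y) + A$1$2 * cnj x * y + A$2$1 * cnj y * x = 0"
    using exists_zero_quadratic .
  define U where "U = mat2 (cnj x) (cnj y) (- y) x"
  have U: "unitary_matrix U"
    using unitary_mat2[of "cnj x" "cnj y"] n by (simp add: U_def)
  define C where "C = U ** A ** ctranspose U"
  have A22: "A $ 2 $ 2 = - A $ 1 $ 1"
    using assms by (simp add: trace_def sum_2 add_eq_0_iff)
  have C11: "C $ 1 $ 1 = 0"
    using xy by (simp add: C_def U_def matrix_matrix_mult_def sum_2 A22 algebra_simps)
  have "trace C = 0"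
    using assms trace_mul_sym[of U "A ** ctranspose U"] unitary_matrixD[OF U]
    by (simp add: C_def matrix_mul_assoc[symmetric])
  then have "C $ 2 $ 2 = 0" using C11 by (simp add: trace_def sum_2)
  then have C: "C = mat2 0 (C $ 1 $ 2) (C $ 2 $ 1) 0"
    using C11 by (simp add: vec_eq_iff forall_2)
  have "A = ctranspose U ** C ** ctranspose (ctranspose U)"
    by (simp add: C_def matrix_mul_assoc[symmetric] unitary_cancel[OF U] unitary_matrixD[OF U])
  then show ?thesis using that[OF unitary_matrix_ctranspose[OF U]] C by metis
qed

section \<open>The A-numerical range of zero-diagonal matrices\<close>

text \<open>The value \<open>tr (A V B V\<^sup>*)\<close> for zero-diagonal \<open>A\<close> and \<open>B\<close> with off-diagonal entries \<open>p, q\<close> and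
  \<open>r, s\<close>, as a real-linear function of \<open>(\<alpha>, \<beta>) = (v\<^sub>1\<^sub>1 cnj v\<^sub>2\<^sub>2, v\<^sub>1\<^sub>2 cnj v\<^sub>2\<^sub>1)\<close>.\<close>

definition trform :: "complex \<Rightarrow> complex \<Rightarrow> complex \<Rightarrow> complex \<Rightarrow> complex \<times> complex \<Rightarrow> complex" where
  "trform p q r s = (\<lambda>(\<alpha>, \<beta>). p * s * cnj \<alpha> + q * r * \<alpha> + p * r * cnj \<beta> + q * s * \<beta>)"

lemma linear_trform: "linear (trform p q r s)"
  by (rule linearI) (auto simp: trform_def algebra_simps scaleR_conv_of_real)

text \<open>The closed unit ball of \<open>\<complex>\<^sup>2\<close> for the norm \<open>|\<alpha>| + |\<beta>|\<close> (the library norm on pairs is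
  the Euclidean one).\<close>

definition l1ball :: "(complex \<times> complex) set" where
  "l1ball = {(\<alpha>, \<beta>). cmod \<alpha> + cmod \<beta> \<le> 1}"

lemma compact_l1ball: "compact l1ball"
proof -
  have "closed {x :: complex \<times> complex. cmod (fst x) + cmod (snd x) \<le> 1}"
    by (intro closed_Collect_le continuous_intros)
  moreover have "bounded {x :: complex \<times> complex. cmod (fst x) + cmod (snd x) \<le> 1}"
    by (rule boundedI[of _ 1]) (auto intro: order_trans[OF norm_Pair_le])
  ultimately show ?thesis
    by (simp add: l1ball_def case_prod_beta' compact_eq_bounded_closed)
qed

text \<open>A real-linear map from \<open>\<complex>\<^sup>2\<close> to \<open>\<complex>\<close> maps the sphere \<open>|\<alpha>| + |\<beta>| = 1\<close> onto the image
  of the whole ball,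
  because every point of the ball can be moved to the sphere along a kernel direction.\<close>

lemma linear_image_l1ball:
  fixes L :: "complex \<times> complex \<Rightarrow> complex"
  assumes L: "linear L" and "cmod \<alpha> + cmod \<beta> \<le> 1"
  obtains \<alpha>' \<beta>' where "cmod \<alpha>' + cmod \<beta>' = 1" "L (\<alpha>', \<beta>') = L (\<alpha>, \<beta>)"
proof -
  \<comment> \<open>The real dimensions are 4 and 2.\<close>
  have "\<not> inj L"
  proof
    assume "inj L"
    then have "dim (range L) = dim (UNIV :: (complex \<times> complex) set)"
      using L by (intro dim_image_eq) auto
    moreover have "dim (range L) \<le> DIM(complex)"
      by (rule dim_subset_UNIV)
    ultimately show False by simp
  qed
  then obtain v where "L v = 0" "v \<noteq> 0"
    using linear_injective_0[OF L] by blast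
  then obtain a b where ab: "L (a, b) = 0" "(a, b) \<noteq> 0" by (cases v) auto
  define f where "f t = cmod (\<alpha> + of_real t * a) + cmod (\<beta> + of_real t * b)" for t
  define N where "N = cmod a + cmod b"
  have N: "N > 0" using ab(2) by (auto simp: N_def zero_prod_def add_pos_nonneg add_nonneg_pos)
  have "1 \<le> f (2 / N)"
  proof -
    have "2 / N * N = cmod (of_real (2/N) * a) + cmod (of_real (2/N) * b)"
      using N unfolding norm_mult norm_of_real N_def[symmetric] distrib_left[symmetric] by simp
    also have "\<dots> \<le> f (2 / N) + (cmod \<alpha> + cmod \<beta>)"
      unfolding f_def
      using norm_triangle_ineq4[of "\<alpha> + of_real (2/N) * a" \<alpha>]
        norm_triangle_ineq4[of "\<beta> + of_real (2/N) * b" \<beta>] by simp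
    finally show ?thesis using N assms(2) by simp
  qed
  moreover have "f 0 \<le> 1" using assms(2) by (simp add: f_def)
  moreover have "continuous_on {0..2/N} f"
    unfolding f_def by (intro continuous_intros)
  ultimately obtain t where t: "f t = 1"
    using IVT'[of f 0 1 "2/N"] N by auto
  have "L ((\<alpha>, \<beta>) + t *\<^sub>R (a, b)) = L (\<alpha>, \<beta>)"
    using ab(1) by (simp only: linear_add[OF L] linear_scale[OF L]) simp
  then show ?thesis
    using that[of "\<alpha> + of_real t * a" "\<beta> + of_real t * b"] t
    by (simp add: f_def scaleR_conv_of_real)
qed

lemma cross_products_le_one:
  fixes a b c d :: real
  assumes "a\<^sup>2 + b\<^sup>2 \<le> 1" "c\<^sup>2 + d\<^sup>2 \<le> 1"
  shows "a * d + b * c \<le> 1"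
  using assms sum_squares_ge_zero[of "a - d" "b - c"] by (simp add: power2_eq_square algebra_simps)

lemma A_numerical_range_offdiag:
  "A_numerical_range (mat2 0 p q 0) (mat2 0 r s 0) = trform p q r s ` l1ball"
proof
  have eq: "trace (mat2 0 p q 0 ** (V ** mat2 0 r s 0 ** ctranspose V))
      = trform p q r s (V$1$1 * cnj (V$2$2), V$1$2 * cnj (V$2$1))" for V :: "complex^2^2"
    by (simp add: trform_def trace_def sum_2 matrix_matrix_mult_def algebra_simps)
  show "A_numerical_range (mat2 0 p q 0) (mat2 0 r s 0) \<subseteq> trform p q r s ` l1ball"
  proof
    fix z assume "z \<in> A_numerical_range (mat2 0 p q 0) (mat2 0 r s 0)"
    then obtain V :: "complex^2^2" where V: "unitary_matrix V"
      and z: "z = trform p q r s (V$1$1 * cnj (V$2$2), V$1$2 * cnj (V$2$1))"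
      by (auto simp: A_numerical_range_def eq)
    have "cmod (V$1$1) * cmod (V$2$2) + cmod (V$1$2) * cmod (V$2$1) \<le> 1"
      using unitary_row_norm[OF V, of 1] unitary_row_norm[OF V, of 2]
      by (intro cross_products_le_one) (simp_all add: sum_2)
    then show "z \<in> trform p q r s ` l1ball"
      unfolding z by (intro imageI) (simp add: l1ball_def norm_mult)
  qed
  show "trform p q r s ` l1ball \<subseteq> A_numerical_range (mat2 0 p q 0) (mat2 0 r s 0)"
  proof
    fix z assume "z \<in> trform p q r s ` l1ball"
    then obtain \<alpha> \<beta> where n: "cmod \<alpha> + cmod \<beta> = 1" and z: "z = trform p q r s (\<alpha>, \<beta>)"
      using linear_image_l1ball[OF linear_trform] by (auto simp: l1ball_def) metis
    \<comment> \<open>For \<open>V\<close> with rows \<open>(g, h)\<close> and \<open>(-cnj h, cnj g)\<close> the two products are \<open>g\<^sup>2\<close> and \<open>-h\<^sup>2\<close>.\<close>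
    define V where "V = mat2 (csqrt \<alpha>) (csqrt (- \<beta>)) (- cnj (csqrt (- \<beta>))) (cnj (csqrt \<alpha>))"
    have "unitary_matrix V"
      unfolding V_def by (rule unitary_mat2) (simp add: n norm_power[symmetric])
    moreover have "z = trace (mat2 0 p q 0 ** (V ** mat2 0 r s 0 ** ctranspose V))"
      unfolding eq z by (simp add: V_def power2_eq_square[symmetric])
    ultimately show "z \<in> A_numerical_range (mat2 0 p q 0) (mat2 0 r s 0)"
      by (auto simp: A_numerical_range_def)
  qed
qed

section \<open>Direct sums with a one-by-one zero matrix\<close>

text \<open>The direct sum of \<open>X\<close> with the \<open>1 \<times> 1\<close> identity matrix. It embeds the unitary \<open>2 \<times> 2\<close> matrices
  into the unitary \<open>3 \<times> 3\<close> matrices, compatibly with conjugation of \<open>X \<oplus> 0\<close>.\<close>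

definition direct_sum_one :: "complex^2^2 \<Rightarrow> complex^3^3" where
  "direct_sum_one X = vector [vector [X $ 1 $ 1, X $ 1 $ 2, 0],
                              vector [X $ 2 $ 1, X $ 2 $ 2, 0],
                              vector [0, 0, 1]]"

lemma ctranspose_direct_sum_one: "ctranspose (direct_sum_one X) = direct_sum_one (ctranspose X)"
  by (simp add: direct_sum_one_def vec_eq_iff forall_3)

lemma direct_sum_one_mult: "direct_sum_one X ** direct_sum_one Y = direct_sum_one (X ** Y)"
  by (simp add: direct_sum_one_def vec_eq_iff forall_3 matrix_matrix_mult_def sum_2 sum_3)

lemma unitary_direct_sum_one: "unitary_matrix U \<Longrightarrow> unitary_matrix (direct_sum_one U)"
  by (simp add: unitary_matrix_def ctranspose_direct_sum_one direct_sum_one_mult)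
     (simp add: direct_sum_one_def vec_eq_iff forall_3 mat_def)

lemma direct_sum_zero_conjugate:
  "direct_sum_zero (U ** A ** ctranspose U)
    = direct_sum_one U ** direct_sum_zero A ** ctranspose (direct_sum_one U)"
  by (simp add: direct_sum_one_def direct_sum_zero_def vec_eq_iff forall_3 matrix_matrix_mult_def
      sum_2 sum_3)

lemma trace_direct_sum_zero_mult:
  "trace (direct_sum_zero A ** direct_sum_zero B) = trace (A ** B)"
  by (simp add: direct_sum_zero_def trace_def matrix_matrix_mult_def sum_2 sum_3)

lemma A_numerical_range_subset_direct_sum_zero:
  "A_numerical_range A B \<subseteq> A_numerical_range (direct_sum_zero A) (direct_sum_zero B)"
proof
  fix z assume "z \<in> A_numerical_range A B"
  then obtain V where V: "unitary_matrix V" and z: "z = trace (A ** (V ** B ** ctranspose V))"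
    by (auto simp: A_numerical_range_def)
  have "z = trace (direct_sum_zero A **
      (direct_sum_one V ** direct_sum_zero B ** ctranspose (direct_sum_one V)))"
    by (simp add: z trace_direct_sum_zero_mult flip: direct_sum_zero_conjugate)
  with unitary_direct_sum_one[OF V]
  show "z \<in> A_numerical_range (direct_sum_zero A) (direct_sum_zero B)"
    by (auto simp: A_numerical_range_def)
qed

text \<open>The trace involves only the upper left \<open>2 \<times> 2\<close> block of \<open>V\<close>. This block need not be unitary,
  but its rows have norm at most one, which is all that the bound on \<open>(\<alpha>, \<beta>)\<close> needs.\<close>

lemma A_numerical_range_direct_sum_zero_offdiag:
  "A_numerical_range (direct_sum_zero (mat2 0 p q 0)) (direct_sum_zero (mat2 0 r s 0))
    \<subseteq> trform p q r s ` l1ball"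
proof
  fix z
  assume "z \<in> A_numerical_range (direct_sum_zero (mat2 0 p q 0)) (direct_sum_zero (mat2 0 r s 0))"
  then obtain V where V: "unitary_matrix V"
    and "z = trace (direct_sum_zero (mat2 0 p q 0) **
        (V ** direct_sum_zero (mat2 0 r s 0) ** ctranspose V))"
    by (auto simp: A_numerical_range_def)
  then have z: "z = trform p q r s (V$1$1 * cnj (V$2$2), V$1$2 * cnj (V$2$1))"
    by (simp add: direct_sum_zero_def trform_def trace_def sum_3 matrix_matrix_mult_def algebra_simps)
  have "(cmod (V$1$1))\<^sup>2 + (cmod (V$1$2))\<^sup>2 + (cmod (V$1$3))\<^sup>2 = 1"
       "(cmod (V$2$1))\<^sup>2 + (cmod (V$2$2))\<^sup>2 + (cmod (V$2$3))\<^sup>2 = 1"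
    using unitary_row_norm[OF V, of 1] unitary_row_norm[OF V, of 2] by (simp_all add: sum_3)
  then have "(cmod (V$1$1))\<^sup>2 + (cmod (V$1$2))\<^sup>2 \<le> 1" "(cmod (V$2$1))\<^sup>2 + (cmod (V$2$2))\<^sup>2 \<le> 1"
    using zero_le_power2[of "cmod (V$1$3)"] zero_le_power2[of "cmod (V$2$3)"] by linarith+
  then have "cmod (V$1$1) * cmod (V$2$2) + cmod (V$1$2) * cmod (V$2$1) \<le> 1"
    by (rule cross_products_le_one)
  then show "z \<in> trform p q r s ` l1ball"
    unfolding z by (intro imageI) (simp add: l1ball_def norm_mult)
qed

lemma A_numerical_range_direct_sum_zero:
  fixes A B :: "complex^2^2"
  assumes "trace A = 0" and "trace B = 0"
  shows "A_numerical_range (direct_sum_zero A) (direct_sum_zero B) = A_numerical_range A B"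
proof (rule antisym[OF _ A_numerical_range_subset_direct_sum_zero])
  obtain U p q where U: "unitary_matrix U" and A: "A = U ** mat2 0 p q 0 ** ctranspose U"
    using trace_zero_similar_offdiag[OF assms(1)] .
  obtain W r s where W: "unitary_matrix W" and B: "B = W ** mat2 0 r s 0 ** ctranspose W"
    using trace_zero_similar_offdiag[OF assms(2)] .
  show "A_numerical_range (direct_sum_zero A) (direct_sum_zero B) \<subseteq> A_numerical_range A B"
    using A_numerical_range_direct_sum_zero_offdiag[of p q r s]
    by (simp add: A B direct_sum_zero_conjugate A_numerical_range_similar U W
        unitary_direct_sum_one A_numerical_range_offdiag)
qed

section \<open>Numerical ranges and the admissible scaling factors\<close>

lemma numerical_range_offdiag_subset:
  assumes "z \<in> numerical_range (mat2 0 p q 0)"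
  obtains w where "cmod w \<le> 1/2" "z = p * w + q * cnj w"
proof -
  obtain x where x: "cdot x x = 1" and z: "z = cdot x (mat2 0 p q 0 *v x)"
    using assms by (auto simp: numerical_range_def)
  have "complex_of_real ((cmod (x$1))\<^sup>2 + (cmod (x$2))\<^sup>2) = 1"
    using x by (simp add: cdot_def sum_2 complex_norm_square mult.commute del: of_real_power)
  then have "(cmod (x$1))\<^sup>2 + (cmod (x$2))\<^sup>2 = 1" by (metis of_real_eq_1_iff)
  then have "cmod (cnj (x$1) * x$2) \<le> 1/2"
    using sum_squares_bound[of "cmod (x$1)" "cmod (x$2)"] by (simp add: norm_mult)
  moreover have "z = p * (cnj (x$1) * x$2) + q * cnj (cnj (x$1) * x$2)"
    by (simp add: z cdot_def sum_2 matrix_vector_mult_def algebra_simps)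
  ultimately show ?thesis using that by blast
qed

text \<open>The modulus \<open>(|p| + |q|)/2\<close> is attained at a vector with entries of equal modulus whose
  relative phase aligns the two summands \<open>p w\<close> and \<open>q cnj w\<close>.\<close>

lemma numerical_range_offdiag_radius:
  obtains z where "z \<in> numerical_range (mat2 0 p q 0)" "cmod z = (cmod p + cmod q) / 2"
proof -
  obtain a where a: "p = of_real (cmod p) * cis a" by (metis rcis_cmod_Arg rcis_def)
  obtain b where b: "q = of_real (cmod q) * cis b" by (metis rcis_cmod_Arg rcis_def)
  define c where "c = (b - a) / 2"
  define k where "k = complex_of_real (1 / sqrt 2)"
  have k: "k * k = 1/2" "cnj k = k" by (simp_all add: k_def flip: of_real_mult)
  define x :: "complex^2" where "x = vector [k, k * cis c]"
  have "cdot x x = k * k * (1 + cis c * cnj (cis c))"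
    by (simp add: cdot_def sum_2 x_def k(2) algebra_simps)
  also have "\<dots> = 1" by (simp add: k(1) cis_cnj cis_mult)
  finally have 1: "cdot x x = 1" .
  have "cdot x (mat2 0 p q 0 *v x) = k * k * (p * cis c + q * cis (- c))"
    by (simp add: cdot_def sum_2 x_def matrix_vector_mult_def cis_cnj k(2) algebra_simps)
  also have "p * cis c = of_real (cmod p) * cis ((a + b) / 2)"
    by (subst a) (simp add: c_def cis_mult field_simps)
  also have "q * cis (- c) = of_real (cmod q) * cis ((a + b) / 2)"
    by (subst b) (simp add: c_def cis_mult field_simps)
  also have "k * k * (of_real (cmod p) * cis ((a + b) / 2) + of_real (cmod q) * cis ((a + b) / 2))
      = of_real ((cmod p + cmod q) / 2) * cis ((a + b) / 2)"
    by (simp add: k(1) algebra_simps)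
  finally have "cmod (cdot x (mat2 0 p q 0 *v x)) = (cmod p + cmod q) / 2"
    by (simp only: norm_mult norm_cis norm_of_real) simp
  with 1 that show ?thesis by (auto simp: numerical_range_def)
qed


lemma scaled_product_two_offdiag:
  "scaled_product 2 (numerical_range (mat2 0 p q 0)) (numerical_range (mat2 0 r s 0))
    \<subseteq> trform p q r s ` l1ball"
proof
  fix u
  assume "u \<in> scaled_product 2 (numerical_range (mat2 0 p q 0)) (numerical_range (mat2 0 r s 0))"
  then obtain a b where a: "a \<in> numerical_range (mat2 0 p q 0)"
    and b: "b \<in> numerical_range (mat2 0 r s 0)" and u: "u = of_real 2 * a * b"
    by (auto simp: scaled_product_def)
  obtain w where w: "cmod w \<le> 1/2" "a = p * w + q * cnj w"
    using numerical_range_offdiag_subset[OF a] .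
  obtain z where z: "cmod z \<le> 1/2" "b = r * z + s * cnj z"
    using numerical_range_offdiag_subset[OF b] .
  have "u = trform p q r s (2 * cnj w * z, 2 * cnj w * cnj z)"
    by (simp add: u w(2) z(2) trform_def algebra_simps)
  moreover have "cmod w * cmod z \<le> 1/2 * (1/2)"
    using w(1) z(1) by (intro mult_mono) auto
  ultimately show "u \<in> trform p q r s ` l1ball"
    by (auto simp: l1ball_def norm_mult)
qed

lemma norm_trform_le:
  assumes "x \<in> l1ball"
  shows "cmod (trform p q r s x) \<le> (cmod p + cmod q) * (cmod r + cmod s)"
proof -
  obtain \<alpha> \<beta> where x: "x = (\<alpha>, \<beta>)" and n: "cmod \<alpha> + cmod \<beta> \<le> 1"
    using assms by (auto simp: l1ball_def)
  have "cmod (trform p q r s x) \<le> cmod (p * s * cnj \<alpha>) + cmod (q * r * \<alpha>)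
      + cmod (p * r * cnj \<beta>) + cmod (q * s * \<beta>)"
    unfolding x trform_def prod.case by (intro norm_triangle_mono order_refl)
  also have "\<dots> = (cmod p * cmod s + cmod q * cmod r) * cmod \<alpha>
      + (cmod p * cmod r + cmod q * cmod s) * cmod \<beta>"
    by (simp add: norm_mult algebra_simps)
  also have "\<dots> \<le> (cmod p + cmod q) * (cmod r + cmod s) * cmod \<alpha>
      + (cmod p + cmod q) * (cmod r + cmod s) * cmod \<beta>"
    by (intro add_mono mult_right_mono) (simp_all add: algebra_simps)
  also have "\<dots> = (cmod p + cmod q) * (cmod r + cmod s) * (cmod \<alpha> + cmod \<beta>)"
    by (simp add: algebra_simps)
  also have "\<dots> \<le> (cmod p + cmod q) * (cmod r + cmod s) * 1"
    using n by (intro mult_left_mono) auto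
  finally show ?thesis by simp
qed

lemma scaled_product_offdiag_le_four:
  assumes sub: "scaled_product c (numerical_range (mat2 0 p q 0)) (numerical_range (mat2 0 r s 0))
      \<subseteq> trform p q r s ` l1ball"
    and "p \<noteq> 0 \<or> q \<noteq> 0" "r \<noteq> 0 \<or> s \<noteq> 0"
  shows "c \<le> 4"
proof -
  define P where "P = (cmod p + cmod q) * (cmod r + cmod s)"
  have P: "P > 0"
    using assms(2,3) unfolding P_def
    by (intro mult_pos_pos) (auto intro: add_pos_nonneg add_nonneg_pos)
  obtain a where a: "a \<in> numerical_range (mat2 0 p q 0)" "cmod a = (cmod p + cmod q) / 2"
    using numerical_range_offdiag_radius .
  obtain b where b: "b \<in> numerical_range (mat2 0 r s 0)" "cmod b = (cmod r + cmod s) / 2"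
    using numerical_range_offdiag_radius .
  have "of_real c * a * b \<in> trform p q r s ` l1ball"
    using sub a(1) b(1) by (auto simp: scaled_product_def)
  then have "cmod (of_real c * a * b) \<le> P"
    using norm_trform_le by (auto simp: P_def)
  then have "\<bar>c\<bar> / 4 * P \<le> 1 * P"
    by (simp add: norm_mult a(2) b(2) P_def)
  then have "\<bar>c\<bar> / 4 \<le> 1"
    using P by (simp only: mult_le_cancel_right_pos)
  then show ?thesis by simp
qed

lemma closed_scaled_product_subset:
  assumes "closed T"
  shows "closed {c. scaled_product c S R \<subseteq> T}"
proof -
  have "{c. scaled_product c S R \<subseteq> T} = (\<Inter>a\<in>S. \<Inter>b\<in>R. (\<lambda>c. of_real c * a * b) -` T)"
    by (auto simp: scaled_product_def)
  moreover have "closed ((\<lambda>c. complex_of_real c * a * b) -` T)" for a b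
    by (intro closed_vimage assms continuous_intros)
  ultimately show ?thesis by (simp add: closed_INT)
qed

theorem corollary12:
  fixes A B :: "complex^2^2"
  assumes "trace A = 0" and "trace B = 0"
  shows "A_numerical_range A B = A_numerical_range (direct_sum_zero A) (direct_sum_zero B) \<and>
    (A \<noteq> 0 \<and> B \<noteq> 0 \<longrightarrow>
      (\<exists>\<alpha>::real.
        scaled_product \<alpha> (numerical_range A) (numerical_range B) \<subseteq> A_numerical_range A B \<and>
        (\<forall>\<beta>::real. scaled_product \<beta> (numerical_range A) (numerical_range B) \<subseteq> A_numerical_range A B
          \<longrightarrow> \<beta> \<le> \<alpha>) \<and>
        2 \<le> \<alpha> \<and> \<alpha> \<le> 4))"
proof (intro conjI impI)
  show "A_numerical_range A B = A_numerical_range (direct_sum_zero A) (direct_sum_zero B)"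
    using A_numerical_range_direct_sum_zero[OF assms] by simp
next
  assume nz: "A \<noteq> 0 \<and> B \<noteq> 0"
  obtain U p q where U: "unitary_matrix U" and A: "A = U ** mat2 0 p q 0 ** ctranspose U"
    using trace_zero_similar_offdiag[OF assms(1)] .
  obtain W r s where W: "unitary_matrix W" and B: "B = W ** mat2 0 r s 0 ** ctranspose W"
    using trace_zero_similar_offdiag[OF assms(2)] .
  have "mat2 0 0 0 0 = 0" by (simp add: vec_eq_iff forall_2)
  then have pq: "p \<noteq> 0 \<or> q \<noteq> 0" and rs: "r \<noteq> 0 \<or> s \<noteq> 0"
    using nz by (auto simp: A B matrix_matrix_mult_def vec_eq_iff)
  have WA: "numerical_range A = numerical_range (mat2 0 p q 0)"
    and WB: "numerical_range B = numerical_range (mat2 0 r s 0)"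
    and WAB: "A_numerical_range A B = trform p q r s ` l1ball"
    by (simp_all add: A B U W numerical_range_similar A_numerical_range_similar
        A_numerical_range_offdiag)
  define K where "K = {c. scaled_product c (numerical_range A) (numerical_range B)
      \<subseteq> A_numerical_range A B}"
  have two: "2 \<in> K"
    using scaled_product_two_offdiag by (simp add: K_def WA WB WAB)
  have four: "c \<le> 4" if "c \<in> K" for c
    using that scaled_product_offdiag_le_four[OF _ pq rs] by (simp add: K_def WA WB WAB)
  have "compact (trform p q r s ` l1ball)"
    by (intro compact_continuous_image linear_continuous_on compact_l1ball)
       (simp add: linear_trform linear_conv_bounded_linear[symmetric])
  then have "closed K"
    unfolding K_def WAB by (intro closed_scaled_product_subset compact_imp_closed)
  moreover have bdd: "bdd_above K" using four by (auto simp: bdd_above_def)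
  ultimately have "Sup K \<in> K"
    using two by (intro closed_contains_Sup) auto
  moreover have "\<forall>c. c \<in> K \<longrightarrow> c \<le> Sup K"
    using bdd by (auto intro: cSup_upper)
  ultimately have "Sup K \<in> K \<and> (\<forall>c. c \<in> K \<longrightarrow> c \<le> Sup K) \<and> 2 \<le> Sup K \<and> Sup K \<le> 4"
    using two four by blast
  then show "\<exists>\<alpha>::real.
        scaled_product \<alpha> (numerical_range A) (numerical_range B) \<subseteq> A_numerical_range A B \<and>
        (\<forall>\<beta>::real. scaled_product \<beta> (numerical_range A) (numerical_range B) \<subseteq> A_numerical_range A B
          \<longrightarrow> \<beta> \<le> \<alpha>) \<and>
        2 \<le> \<alpha> \<and> \<alpha> \<le> 4"
    unfolding K_def mem_Collect_eq by blast
qed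

end
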